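(* Let $X$ be a (real) locally convex topological vector space, let $\mathcal{F}\subset X^{*}\oplus\mathbb{R}$ be any subset, and let $$K=\{x\in X: f(x)\le\alpha\ \ \forall(f,\alpha)\in\mathcal{F}\}.$$ Suppose that $K$ is non-empty. Let $\widehat{\mathcal{F}}$ be the smallest weak-* closed convex cone in $X^{*}\oplus\mathbb{R}$ containing $\mathcal{F}$. Let $h\in X^{*}$, let $m=\sup_{x\in K}h(x)$, and let $\widehat{\mathcal{F}}_{h}=\{\alpha\in\mathbb{R}:(h,\alpha)\in\widehat{\mathcal{F}}\}$. Then $$m=\min\widehat{\mathcal{F}}_{h},$$ where the minimum is achieved if $\widehat{\mathcal{F}}_{h}\neq\emptyset$, and the right-hand side is interpreted as $+\infty$ if $\widehat{\mathcal{F}}_{h}=\emptyset$.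
   Context: $X^{*}$ is the space of continuous linear functionals on $X$. The weak-* topology of $X^{*}\oplus\mathbb{R}$ is the product of the weak-* topology of $X^{*}$ (the topology of pointwise convergence on $X$) and the usual topology of $\mathbb{R}$. A convex cone is a convex set containing the origin and closed under multiplication by nonnegative numbers. *)

theory Defs
  imports "HOL-Analysis.Analysis"
begin

text \<open>As in the library's topological algebraic classes, no separation axiom is required:
  topological vector spaces need not be Hausdorff.\<close>

class topological_real_vector = real_vector + topological_ab_group_add +
  assumes tendsto_scaleR_Pair:
    "((\<lambda>p. fst p *\<^sub>R snd p) \<longlongrightarrow> c *\<^sub>R x) (nhds (c::real) \<times>\<^sub>F nhds x)"

class locally_convex_space = topological_real_vector +
  assumes locally_convex_zero:
    "open U \<Longrightarrow> 0 \<in> U \<Longrightarrow> \<exists>V C. open V \<and> 0 \<in> V \<and> V \<subseteq> C \<and> C \<subseteq> U \<and>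
       (\<forall>x\<in>C. \<forall>y\<in>C. \<forall>u\<ge>0. \<forall>v\<ge>0. u + v = 1 \<longrightarrow> u *\<^sub>R x + v *\<^sub>R y \<in> C)"
    \<comment> \<open>the last line is \<open>convex C\<close>, which cannot be used on the type of a class being declared\<close>

instance real_normed_vector \<subseteq> locally_convex_space
proof
  show "((\<lambda>p. fst p *\<^sub>R snd p) \<longlongrightarrow> c *\<^sub>R x) (nhds c \<times>\<^sub>F nhds x)" for c and x :: 'a
    unfolding nhds_prod[symmetric]
    by (intro tendsto_scaleR tendsto_fst[of "\<lambda>p. p" "(c, x)", simplified]
        tendsto_snd[of "\<lambda>p. p" "(c, x)", simplified] filterlim_ident)
next
  fix U :: "'a set"
  assume "open U" "0 \<in> U"
  then obtain e where "e > 0" "ball 0 e \<subseteq> U"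
    by (meson open_contains_ball)
  then show "\<exists>V C. open V \<and> 0 \<in> V \<and> V \<subseteq> C \<and> C \<subseteq> U \<and>
       (\<forall>x\<in>C. \<forall>y\<in>C. \<forall>u\<ge>0. \<forall>v\<ge>0. u + v = 1 \<longrightarrow> u *\<^sub>R x + v *\<^sub>R y \<in> C)"
    using convex_ball[of "0::'a" e] unfolding convex_def
    by (intro exI[of _ "ball 0 e"]) auto
qed

typedef (overloaded) ('a::topological_real_vector) continuous_dual =
    "{f :: 'a \<Rightarrow> real. linear f \<and> continuous_on UNIV f}"
  morphisms dual_apply Abs_continuous_dual
  by (rule exI[of _ "\<lambda>_. 0"]) (simp add: linear_iff)

setup_lifting type_definition_continuous_dual

instantiation continuous_dual :: (topological_real_vector) real_vector
begin

lift_definition zero_continuous_dual :: "'a continuous_dual" is "\<lambda>_. 0"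
  by (simp add: linear_iff)

lift_definition plus_continuous_dual ::
  "'a continuous_dual \<Rightarrow> 'a continuous_dual \<Rightarrow> 'a continuous_dual" is "\<lambda>f g x. f x + g x"
  by (auto simp: linear_iff algebra_simps intro!: continuous_intros)

lift_definition minus_continuous_dual ::
  "'a continuous_dual \<Rightarrow> 'a continuous_dual \<Rightarrow> 'a continuous_dual" is "\<lambda>f g x. f x - g x"
  by (auto simp: linear_iff algebra_simps intro!: continuous_intros)

lift_definition uminus_continuous_dual ::
  "'a continuous_dual \<Rightarrow> 'a continuous_dual" is "\<lambda>f x. - f x"
  by (auto simp: linear_iff intro!: continuous_intros)

lift_definition scaleR_continuous_dual ::
  "real \<Rightarrow> 'a continuous_dual \<Rightarrow> 'a continuous_dual" is "\<lambda>c f x. c * f x"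
  by (auto simp: linear_iff algebra_simps intro!: continuous_intros)

instance
  by standard (transfer; simp add: fun_eq_iff algebra_simps)+

end

text \<open>The dual carries the weak-* topology, i.e. the one induced by its inclusion into
  \<^typ>\<open>'a \<Rightarrow> real\<close>, on which the library's \<^const>\<open>open\<close> is the topology of pointwise convergence.
  Consequently \<^const>\<open>open\<close> and \<^const>\<open>closed\<close> on \<^typ>\<open>'a continuous_dual \<times> real\<close>
  refer to the product of the weak-* topology and the usual topology of the reals.\<close>

instantiation continuous_dual :: (topological_real_vector) topological_space
begin

definition open_continuous_dual :: "'a continuous_dual set \<Rightarrow> bool" where
  "open_continuous_dual U \<longleftrightarrow> (\<exists>V :: ('a \<Rightarrow> real) set. open V \<and> U = dual_apply -` V)"

instance
proof
  show "open (UNIV :: 'a continuous_dual set)"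
    unfolding open_continuous_dual_def by (rule exI[of _ UNIV]) simp
next
  fix S T :: "'a continuous_dual set"
  assume "open S" "open T"
  then show "open (S \<inter> T)"
    unfolding open_continuous_dual_def by (metis open_Int vimage_Int)
next
  fix \<S> :: "'a continuous_dual set set"
  assume "\<forall>S\<in>\<S>. open S"
  then obtain V where V: "\<And>S. S \<in> \<S> \<Longrightarrow> open (V S) \<and> S = dual_apply -` V S"
    unfolding open_continuous_dual_def by metis
  have "\<Union>\<S> = dual_apply -` (\<Union>S\<in>\<S>. V S)"
    using V by (auto simp: vimage_UN)
  then show "open (\<Union>\<S>)"
    unfolding open_continuous_dual_def using V by (metis (no_types, lifting) open_UN)
qed

end

text \<open>The smallest closed convex cone containing a set; \<^const>\<open>convex_cone\<close> includes
  nonemptiness, hence membership of the origin.\<close>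

definition closed_convex_cone_hull :: "'a::{real_vector, topological_space} set \<Rightarrow> 'a set" where
  "closed_convex_cone_hull S = (\<lambda>C. convex_cone C \<and> closed C) hull S"

lemma closed_convex_cone_hull:
  fixes S :: "'a::{real_vector, topological_space} set"
  shows "convex_cone (closed_convex_cone_hull S)" "closed (closed_convex_cone_hull S)"
    "S \<subseteq> closed_convex_cone_hull S"
    "\<And>C. \<lbrakk>convex_cone C; closed C; S \<subseteq> C\<rbrakk> \<Longrightarrow> closed_convex_cone_hull S \<subseteq> C"
proof -
  show "convex_cone (closed_convex_cone_hull S)"
    unfolding closed_convex_cone_hull_def hull_def convex_cone_iff by blast
  show "closed (closed_convex_cone_hull S)"
    unfolding closed_convex_cone_hull_def hull_def by (intro closed_Inter) blast
qed (simp_all add: closed_convex_cone_hull_def hull_subset hull_minimal)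

end

theory Submission
  imports Defs
begin

text \<open>The substance of the theorem is that the best valid inequality \<open>h \<le> m\<close> on \<open>K\<close> belongs to the
  weak-* closure of the nonnegative combinations of the given inequalities. Conversely, no \<open>\<beta>\<close> with
  \<open>(h, \<beta>)\<close> in the hull can lie below the supremum \<open>m\<close>, because the valid inequalities form a closed
  convex cone containing \<open>F\<close> (\<open>hull_imp_valid\<close>). So it is enough to show that \<open>(h, m)\<close> lies in the
  hull whenever \<open>m\<close> is finite (\<open>sharp_bound_mem_hull\<close>); this also shows that the fibre over \<open>h\<close>
  can only be empty if \<open>m\<close> is infinite.

  If \<open>(h, m)\<close> were not in the hull, it could be separated from it by a weak-* continuous functional
  \<open>(f, \<alpha>) \<mapsto> f y + s \<alpha>\<close>, nonpositive on the hull and positive at \<open>(h, m)\<close>. The sign of \<open>s\<close> decides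
  which contradiction results. With \<open>x = - y / s\<close>: if \<open>s < 0\<close>, then \<open>x\<close> is a point of \<open>K\<close> with
  \<open>h x > m\<close>. If \<open>s = 0\<close>, then \<open>y\<close> is a recession direction of \<open>K\<close> along which \<open>h\<close> increases. If
  \<open>s > 0\<close>, then \<open>f x \<ge> \<alpha>\<close> for every constraint, while \<open>h x < m\<close>; for a
  point \<open>z\<close> of \<open>K\<close> with \<open>h z > h x\<close>, the difference \<open>z - x\<close> is again a recession direction along
  which \<open>h\<close> increases.

  The separation (\<open>weak_star_separation\<close>) is finite-dimensional: a basic weak-* neighbourhood only
  looks at finitely many evaluations, and the separating functional is a linear
  combination of these. The coefficients are the residual vector of the point of the closed cone
  that is nearest to the given one in the Euclidean norm of these evaluations
  (\<open>convex_cone_separation\<close>).\<close>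

section \<open>Separating a point from a convex cone by finitely many functionals\<close>

text \<open>The first-order condition for a shortest vector: since
  \<open>\<Sum>(v + r u)\<^sup>2 = \<Sum>v\<^sup>2 + r (2 \<Sum>v u + r \<Sum>u\<^sup>2)\<close>, a negative cross term would dominate for
  small \<open>r\<close>.\<close>

lemma cross_sum_nonneg_if_minimal:
  fixes v u :: "'i \<Rightarrow> real"
  assumes min: "\<And>r. 0 \<le> r \<Longrightarrow> r \<le> 1 \<Longrightarrow> (\<Sum>i\<in>I. (v i)\<^sup>2) \<le> (\<Sum>i\<in>I. (v i + r * u i)\<^sup>2)"
  shows "0 \<le> (\<Sum>i\<in>I. v i * u i)"
proof (rule ccontr)
  define a b where "a = (\<Sum>i\<in>I. v i * u i)" and "b = (\<Sum>i\<in>I. (u i)\<^sup>2)"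
  assume "\<not> ?thesis"
  then have a: "a < 0" by (simp add: a_def)
  have b: "0 \<le> b" by (simp add: b_def sum_nonneg)
  define r where "r = min 1 (- a / (b + 1))"
  have r: "0 < r" "r \<le> 1" "r \<le> - a / (b + 1)"
    using a b by (auto simp: r_def divide_neg_pos)
  have "(\<Sum>i\<in>I. (v i + r * u i)\<^sup>2) = (\<Sum>i\<in>I. (v i)\<^sup>2) + r * (2 * a + r * b)"
    by (simp add: a_def b_def power2_eq_square algebra_simps sum.distrib sum_distrib_left)
  with min[of r] r have "0 \<le> r * (2 * a + r * b)" by simp
  then have "0 \<le> 2 * a + r * b" using r by (simp add: zero_le_mult_iff)
  moreover have "r * (b + 1) \<le> - a" using r(3) b by (simp add: field_simps)
  ultimately show False using a r(1) by (simp add: algebra_simps)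
qed

text \<open>The number of functionals is arbitrary, so instead of a Euclidean space the argument uses the
  vectors in \<open>'i \<Rightarrow> real\<close> that vanish off \<open>I\<close>, in the topology of pointwise convergence. The weights
  are a shortest vector \<open>v\<close> in the closure of the residuals \<open>p - c\<close>, \<open>c \<in> C\<close>. Adding elements of
  \<open>C\<close> to \<open>c\<close> changes residuals within this set, which makes \<open>v\<close> nonpositive on \<open>C\<close>; moving
  towards the residual \<open>p\<close> of the apex shows that the value of \<open>v\<close> at \<open>p\<close> is at least
  the squared length of \<open>v\<close>.\<close>

lemma convex_cone_separation:
  fixes C :: "'b::real_vector set" and e :: "'i \<Rightarrow> 'b \<Rightarrow> real"
  assumes C: "convex_cone C"
    and fin: "finite I"
    and lin: "\<And>i. i \<in> I \<Longrightarrow> linear (e i)"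
    and U: "\<And>i. i \<in> I \<Longrightarrow> open (U i)" "\<And>i. i \<in> I \<Longrightarrow> e i p \<in> U i"
    and avoid: "\<And>c. c \<in> C \<Longrightarrow> \<exists>i\<in>I. e i c \<notin> U i"
  shows "\<exists>w. (\<forall>c\<in>C. (\<Sum>i\<in>I. w i * e i c) \<le> 0) \<and> 0 < (\<Sum>i\<in>I. w i * e i p)"
proof -
  define T where "T = (\<lambda>b i. if i \<in> I then e i b else 0)"
  define S where "S = (\<lambda>c. T (p - c)) ` C"
  define q :: "('i \<Rightarrow> real) \<Rightarrow> real" where "q = (\<lambda>v. \<Sum>i\<in>I. (v i)\<^sup>2)"
  \<comment> \<open>The summand 1 ensures \<open>M \<ge> 1\<close>, so that a coordinate beyond \<open>M\<close> has its square beyond \<open>q (T p)\<close>.\<close>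
  define M where "M = q (T p) + 1"
  define B where "B = PiE UNIV (\<lambda>i. if i \<in> I then {-M..M} else {0::real})"
  have Tdiff: "T (a - b) = (\<lambda>i. T a i - T b i)" for a b
    using lin by (auto simp: T_def fun_eq_iff linear_diff)
  have Tscale: "T (r *\<^sub>R a) = (\<lambda>i. r * T a i)" for a r
    using lin by (auto simp: T_def fun_eq_iff linear_scale)
  have Tadd: "T (a + b) = (\<lambda>i. T a i + T b i)" for a b
    using lin by (auto simp: T_def fun_eq_iff linear_add)
  have contq: "continuous_on A q" for A
    unfolding q_def by (intro continuous_intros continuous_on_subset[OF continuous_on_product_coordinates]) auto
  have qT: "0 \<le> q v" for v
    by (simp add: q_def sum_nonneg)
  have coord_le: "(v i)\<^sup>2 \<le> q v" if "i \<in> I" for v i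
    unfolding q_def using that fin by (intro member_le_sum) auto
  \<comment> \<open>The residuals no longer than the residual \<open>T p\<close> of the apex lie in the box \<open>B\<close>, which is
    compact by Tychonoff's theorem, so a shortest one exists in the closure.\<close>
  have "compactin (product_topology (\<lambda>i. euclidean) UNIV) B"
    unfolding B_def by (subst compactin_PiE) auto
  then have "compact B"
    by (simp add: euclidean_product_topology)
  then have comp: "compact (closure S \<inter> B)"
    by (rule closed_Int_compact[OF closed_closure])
  have TpS: "T p \<in> S"
    unfolding S_def using convex_cone_contains_0[OF C] by (intro image_eqI[of _ _ 0]) auto
  have inB: "v \<in> B" if v: "v \<in> closure S" "q v \<le> q (T p)" for v
  proof -
    have cl: "closed {v. v i = (0::real)}" for i :: 'i
      by (intro closed_Collect_eq continuous_on_product_coordinates continuous_on_const)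
    have "closure S \<subseteq> {v. v i = 0}" if "i \<notin> I" for i
      by (rule closure_minimal[OF _ cl]) (use that in \<open>auto simp: S_def T_def\<close>)
    moreover have "\<bar>v i\<bar> \<le> M" if "i \<in> I" for i
    proof (rule ccontr)
      assume "\<not> ?thesis"
      then have "M < \<bar>v i\<bar>" by simp
      moreover have "1 \<le> M" using qT[of "T p"] by (simp add: M_def)
      ultimately have "M * 1 < \<bar>v i\<bar> * \<bar>v i\<bar>"
        by (intro mult_strict_mono') auto
      then show False using coord_le[OF that, of v] v(2)
        by (simp add: M_def power2_eq_square abs_mult_self_eq)
    qed
    ultimately show ?thesis
      using v(1) unfolding B_def by (auto simp: PiE_iff abs_le_iff minus_le_iff)
  qed
  have TpB: "T p \<in> closure S \<inter> B"
    using TpS inB closure_subset by blast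
  then obtain v where v: "v \<in> closure S" "\<And>u. u \<in> closure S \<inter> B \<Longrightarrow> q v \<le> q u"
    using continuous_attains_inf[OF comp _ contq] by blast
  have vmin: "q v \<le> q u" if "u \<in> closure S" for u
    using v(2)[OF TpB] v(2)[of u] inB[of u] that by fastforce
  \<comment> \<open>Both perturbations of \<open>v\<close> used below arise from affine maps that send residuals to residuals;
    by continuity such maps preserve the closure as well.\<close>
  have affine: "(\<lambda>i. s * v i + t i) \<in> closure S"
    if "\<And>u. u \<in> S \<Longrightarrow> (\<lambda>i. s * u i + t i) \<in> S" for s t
  proof -
    have "(\<lambda>u i. s * u i + t i) ` closure S \<subseteq> closure S"
      by (rule image_closure_subset)
        (use that closure_subset[of S] in \<open>auto intro!: continuous_on_coordinatewise_then_product
            continuous_intros continuous_on_subset[OF continuous_on_product_coordinates]\<close>)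
    then show ?thesis using v(1) by blast
  qed
  have le: "(\<Sum>i\<in>I. v i * e i c) \<le> 0" if c: "c \<in> C" for c
  proof -
    have "0 \<le> (\<Sum>i\<in>I. v i * (- T c i))"
    proof (rule cross_sum_nonneg_if_minimal)
      fix r :: real assume r: "0 \<le> r"
      have "(\<lambda>i. 1 * v i + (- r * T c i)) \<in> closure S"
      proof (rule affine)
        fix u assume "u \<in> S"
        then obtain d where d: "d \<in> C" "u = T (p - d)" by (auto simp: S_def)
        have "(\<lambda>i. 1 * u i + (- r * T c i)) = T (p - (d + r *\<^sub>R c))"
          unfolding d Tdiff Tadd Tscale by (simp add: algebra_simps)
        moreover have "d + r *\<^sub>R c \<in> C"
          using C c d r by (simp add: convex_cone_add convex_cone_scaleR)
        ultimately show "(\<lambda>i. 1 * u i + (- r * T c i)) \<in> S"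
          by (auto simp: S_def)
      qed
      from vmin[OF this] show "(\<Sum>i\<in>I. (v i)\<^sup>2) \<le> (\<Sum>i\<in>I. (v i + r * - T c i)\<^sup>2)"
        by (simp add: q_def)
    qed
    then show ?thesis by (simp add: T_def sum_negf)
  qed
  have "0 \<le> (\<Sum>i\<in>I. v i * (T p i - v i))"
  proof (rule cross_sum_nonneg_if_minimal)
    fix r :: real assume r: "0 \<le> r" "r \<le> 1"
    have "(\<lambda>i. (1 - r) * v i + r * T p i) \<in> closure S"
    proof (rule affine)
      fix u assume "u \<in> S"
      then obtain d where d: "d \<in> C" "u = T (p - d)" by (auto simp: S_def)
      have "(\<lambda>i. (1 - r) * u i + r * T p i) = T (p - (1 - r) *\<^sub>R d)"
        unfolding d Tdiff Tscale by (simp add: algebra_simps)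
      moreover have "(1 - r) *\<^sub>R d \<in> C"
        using C d r by (simp add: convex_cone_scaleR)
      ultimately show "(\<lambda>i. (1 - r) * u i + r * T p i) \<in> S"
        by (auto simp: S_def)
    qed
    from vmin[OF this] show "(\<Sum>i\<in>I. (v i)\<^sup>2) \<le> (\<Sum>i\<in>I. (v i + r * (T p i - v i))\<^sup>2)"
      by (simp add: q_def algebra_simps)
  qed
  then have ge: "q v \<le> (\<Sum>i\<in>I. v i * e i p)"
    by (simp add: q_def T_def right_diff_distrib sum_subtractf power2_eq_square)
  \<comment> \<open>The neighbourhood of \<open>p\<close> that avoids \<open>C\<close> becomes a neighbourhood \<open>N\<close> of the zero residual,
    so \<open>v\<close> is not zero.\<close>
  define N where "N = (\<Inter>i\<in>I. (\<lambda>v. e i p - v i) -` U i)"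
  have "open N" unfolding N_def
    using U(1) fin by (intro open_INT ballI open_vimage continuous_intros
        continuous_on_product_coordinates) auto
  moreover have "N \<inter> S = {}"
    using avoid lin by (fastforce simp: N_def S_def T_def linear_diff)
  ultimately have "N \<inter> closure S = {}"
    by (simp add: open_Int_closure_eq_empty)
  then have "v \<notin> N" using v(1) by blast
  then obtain i where i: "i \<in> I" "e i p - v i \<notin> U i" by (auto simp: N_def)
  then have "v i \<noteq> 0" using U(2)[of i] by auto
  then have "0 < q v"
    using coord_le[OF i(1), of v] by (metis less_le_trans zero_less_power2)
  with ge le show ?thesis by (intro exI[of _ v]) auto
qed

section \<open>Separation in the weak-* topology\<close>

lemma linear_dual_apply: "linear (dual_apply f)"
  using dual_apply[of f] by simp

text \<open>A weak-* continuous functional on the dual is an evaluation at a point; here that point comes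
  out as the combination, with the weights of the finite-dimensional separation, of the points that
  determine a neighbourhood of \<open>(h, r)\<close> avoiding \<open>C\<close>.\<close>

lemma weak_star_separation:
  fixes C :: "('a::topological_real_vector continuous_dual \<times> real) set"
  assumes C: "convex_cone C" "closed C" and p: "(h, r) \<notin> C"
  shows "\<exists>x s. (\<forall>(f, \<alpha>)\<in>C. dual_apply f x + s * \<alpha> \<le> 0) \<and> 0 < dual_apply h x + s * r"
proof -
  have "open (- C)" "(h, r) \<in> - C" using C(2) p by auto
  then obtain A D where AD: "open A" "open D" "h \<in> A" "r \<in> D" "A \<times> D \<subseteq> - C"
    unfolding open_prod_def mem_Times_iff by (metis fst_conv snd_conv)
  obtain V where V: "open V" "A = dual_apply -` V"
    using AD(1) by (auto simp: open_continuous_dual_def)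
  obtain X where X: "dual_apply h \<in> PiE UNIV X" "\<And>x. open (X x)" "finite {x. X x \<noteq> UNIV}"
      "PiE UNIV X \<subseteq> V"
    using product_topology_open_contains_basis[of "\<lambda>_. euclidean" UNIV V "dual_apply h"] V AD(3)
    by (auto simp: open_fun_def)
  define J where "J = {x. X x \<noteq> UNIV}"
  define I where "I = insert None (Some ` J)"
  \<comment> \<open>The index \<open>None\<close> stands for the real component, \<open>Some x\<close> for evaluation at \<open>x\<close>.\<close>
  define e where "e = (\<lambda>i (g :: 'a continuous_dual, \<beta> :: real).
      case i of None \<Rightarrow> \<beta> | Some x \<Rightarrow> dual_apply g x)"
  define U where "U = (\<lambda>i. case i of None \<Rightarrow> D | Some x \<Rightarrow> X x)"
  have "\<exists>w. (\<forall>c\<in>C. (\<Sum>i\<in>I. w i * e i c) \<le> 0) \<and> 0 < (\<Sum>i\<in>I. w i * e i (h, r))"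
  proof (rule convex_cone_separation[OF C(1)])
    show "finite I" using X(3) by (simp add: I_def J_def)
    show "linear (e i)" for i
      by (cases i) (auto simp: e_def linear_iff plus_continuous_dual.rep_eq
          scaleR_continuous_dual.rep_eq)
    show "open (U i)" for i using X(2) AD(2) by (auto simp: U_def split: option.split)
    show "e i (h, r) \<in> U i" for i
      using X(1) AD(4) by (auto simp: U_def e_def split: option.split)
    show "\<exists>i\<in>I. e i c \<notin> U i" if c: "c \<in> C" for c
    proof (rule ccontr)
      assume no: "\<not> ?thesis"
      obtain g \<beta> where g: "c = (g, \<beta>)" by (cases c)
      have "\<beta> \<in> D" using no by (auto simp: I_def g e_def U_def)
      moreover have "dual_apply g x \<in> X x" for x
        using no by (cases "x \<in> J") (auto simp: I_def g e_def U_def J_def)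
      then have "g \<in> A" using X(4) V(2) by auto
      ultimately show False using AD(5) c g by auto
    qed
  qed
  then obtain w where w: "\<And>c. c \<in> C \<Longrightarrow> (\<Sum>i\<in>I. w i * e i c) \<le> 0" "0 < (\<Sum>i\<in>I. w i * e i (h, r))"
    by blast
  have eval: "(\<Sum>i\<in>I. w i * e i (g, \<beta>)) = dual_apply g (\<Sum>x\<in>J. w (Some x) *\<^sub>R x) + w None * \<beta>" for g \<beta>
    using X(3) by (simp add: I_def J_def e_def sum.reindex linear_sum[OF linear_dual_apply]
        linear_scale[OF linear_dual_apply])
  show ?thesis
  proof (intro exI conjI ballI)
    show "0 < dual_apply h (\<Sum>x\<in>J. w (Some x) *\<^sub>R x) + w None * r"
      using w(2) by (simp add: eval)
    show "case c of (f, \<alpha>) \<Rightarrow> dual_apply f (\<Sum>x\<in>J. w (Some x) *\<^sub>R x) + w None * \<alpha> \<le> 0"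
      if "c \<in> C" for c
      using w(1)[OF that] by (cases c) (simp add: eval)
  qed
qed

section \<open>Valid inequalities and the closed convex cone hull\<close>

lemma closed_valid_inequalities:
  fixes K :: "'a::topological_real_vector set"
  shows "closed {(f, \<alpha>). \<forall>x\<in>K. dual_apply f x \<le> \<alpha>}"
proof -
  have cont: "continuous_on UNIV (\<lambda>f. dual_apply f x)" for x :: 'a
    unfolding continuous_on_open_vimage[OF open_UNIV]
  proof (intro allI impI)
    fix B :: "real set" assume "open B"
    then have "open ((\<lambda>v :: 'a \<Rightarrow> real. v x) -` B)"
      by (rule open_vimage) (rule continuous_on_product_coordinates)
    then show "open ((\<lambda>f. dual_apply f x) -` B \<inter> UNIV)"
      unfolding open_continuous_dual_def by (intro exI[of _ "(\<lambda>v. v x) -` B"]) auto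
  qed
  have "closed {p. dual_apply (fst p) x \<le> snd p}" for x :: 'a
    by (intro closed_Collect_le continuous_on_compose2[OF cont] continuous_intros) auto
  then have "closed (\<Inter>x\<in>K. {p. dual_apply (fst p) x \<le> snd p})" by blast
  also have "(\<Inter>x\<in>K. {p. dual_apply (fst p) x \<le> snd p}) = {(f, \<alpha>). \<forall>x\<in>K. dual_apply f x \<le> \<alpha>}"
    by auto
  finally show ?thesis .
qed

lemma hull_imp_valid:
  assumes "(f, \<alpha>) \<in> closed_convex_cone_hull F"
    and "\<And>g \<beta> x. (g, \<beta>) \<in> F \<Longrightarrow> x \<in> K \<Longrightarrow> dual_apply g x \<le> \<beta>" and "x \<in> K"
  shows "dual_apply f x \<le> \<alpha>"
proof -
  let ?P = "{(f, \<alpha>). \<forall>x\<in>K. dual_apply f x \<le> \<alpha>}"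
  have "convex_cone ?P"
    by (auto simp: convex_cone_iff zero_prod_def zero_continuous_dual.rep_eq
        plus_continuous_dual.rep_eq scaleR_continuous_dual.rep_eq add_mono mult_left_mono)
  then have "closed_convex_cone_hull F \<subseteq> ?P"
    by (rule closed_convex_cone_hull(4)[OF _ closed_valid_inequalities]) (use assms(2) in auto)
  with assms(1,3) show ?thesis by auto
qed

text \<open>A direction \<open>d\<close> along which no constraint increases can be followed indefinitely from a
  feasible point \<open>z\<close>, so a functional bounded above on the feasible set cannot increase along it.\<close>

lemma bounded_above_imp_recession_nonpos:
  assumes z: "\<And>f \<alpha>. (f, \<alpha>) \<in> F \<Longrightarrow> dual_apply f z \<le> \<alpha>"
    and d: "\<And>f \<alpha>. (f, \<alpha>) \<in> F \<Longrightarrow> dual_apply f d \<le> 0"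
    and bound: "\<And>x. (\<And>f \<alpha>. (f, \<alpha>) \<in> F \<Longrightarrow> dual_apply f x \<le> \<alpha>) \<Longrightarrow> dual_apply h x \<le> b"
  shows "dual_apply h d \<le> 0"
proof (rule ccontr)
  assume "\<not> ?thesis"
  then have pos: "0 < dual_apply h d" by simp
  define t where "t = (b + 1 - dual_apply h z) / dual_apply h d"
  have apply_ray: "dual_apply f (z + s *\<^sub>R d) = dual_apply f z + s * dual_apply f d" for f s
    by (simp add: linear_add[OF linear_dual_apply] linear_scale[OF linear_dual_apply])
  have "0 \<le> t" using bound[of z] z pos by (simp add: t_def)
  then have "dual_apply h (z + t *\<^sub>R d) \<le> b"
  proof (intro bound)
    fix f \<alpha> assume f: "(f, \<alpha>) \<in> F"
    have "t * dual_apply f d \<le> 0" using \<open>0 \<le> t\<close> d[OF f] by (rule mult_nonneg_nonpos)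
    then show "dual_apply f (z + t *\<^sub>R d) \<le> \<alpha>" using z[OF f] by (simp add: apply_ray)
  qed
  moreover have "dual_apply h (z + t *\<^sub>R d) = b + 1"
    using pos by (simp add: apply_ray t_def)
  ultimately show False by simp
qed

text \<open>The hypothesis \<open>approx\<close> does two things: it makes \<open>K\<close> nonempty, which provides the starting
  point of the ray when \<open>s = 0\<close>, and it provides a point of \<open>K\<close> that is better than \<open>x\<close> when
  \<open>s > 0\<close>.\<close>

lemma sharp_bound_mem_hull:
  fixes F :: "('a::topological_real_vector continuous_dual \<times> real) set"
  defines "K \<equiv> {x. \<forall>(f, \<alpha>)\<in>F. dual_apply f x \<le> \<alpha>}"
  assumes bound: "\<And>x. x \<in> K \<Longrightarrow> dual_apply h x \<le> m"
    and approx: "\<And>b. b < m \<Longrightarrow> \<exists>x\<in>K. b < dual_apply h x"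
  shows "(h, m) \<in> closed_convex_cone_hull F"
proof (rule ccontr)
  assume notin: "(h, m) \<notin> closed_convex_cone_hull F"
  obtain y s
    where sep: "\<forall>(f, \<alpha>)\<in>closed_convex_cone_hull F. dual_apply f y + s * \<alpha> \<le> 0"
      and pos: "0 < dual_apply h y + s * m"
    using weak_star_separation[OF closed_convex_cone_hull(1,2) notin] by blast
  have sepF: "dual_apply f y + s * \<alpha> \<le> 0" if "(f, \<alpha>) \<in> F" for f \<alpha>
    using sep closed_convex_cone_hull(3)[of F] that by blast
  have recession: "dual_apply h d \<le> 0"
    if "z \<in> K" "\<And>f \<alpha>. (f, \<alpha>) \<in> F \<Longrightarrow> dual_apply f d \<le> 0" for z d
  proof (rule bounded_above_imp_recession_nonpos[OF _ that(2)])
    show "dual_apply f z \<le> \<alpha>" if "(f, \<alpha>) \<in> F" for f \<alpha>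
      using \<open>z \<in> K\<close> that by (auto simp: K_def)
    show "dual_apply h x \<le> m" if "\<And>f \<alpha>. (f, \<alpha>) \<in> F \<Longrightarrow> dual_apply f x \<le> \<alpha>" for x
      using that by (intro bound) (auto simp: K_def)
  qed
  define x where "x = (- 1 / s) *\<^sub>R y"
  have apply_x: "dual_apply f x = - dual_apply f y / s" for f
    unfolding x_def linear_scale[OF linear_dual_apply] by simp
  consider "s < 0" | "s = 0" | "0 < s" by linarith
  then show False
  proof cases
    case 1
    have "dual_apply f x \<le> \<alpha>" if "(f, \<alpha>) \<in> F" for f \<alpha>
      using sepF[OF that] 1 by (simp add: apply_x field_simps)
    then have "x \<in> K" by (auto simp: K_def)
    then have "dual_apply h x \<le> m" by (rule bound)
    with pos 1 show False by (simp add: apply_x field_simps)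
  next
    case 2
    obtain z where z: "z \<in> K" using approx[of "m - 1"] by auto
    have "dual_apply h y \<le> 0"
      by (rule recession[OF z]) (use sepF 2 in simp)
    with pos 2 show False by simp
  next
    case 3
    have "dual_apply h x < m" using pos 3 by (simp add: apply_x field_simps)
    with approx obtain z where z: "z \<in> K" "dual_apply h x < dual_apply h z" by blast
    have diff: "dual_apply f (z - x) = dual_apply f z - dual_apply f x" for f
      by (rule linear_diff[OF linear_dual_apply])
    have "dual_apply f (z - x) \<le> 0" if "(f, \<alpha>) \<in> F" for f \<alpha>
    proof -
      have "dual_apply f z \<le> \<alpha>" using z(1) that by (auto simp: K_def)
      also have "\<alpha> \<le> dual_apply f x"
        using sepF[OF that] 3 by (simp add: apply_x field_simps)
      finally show ?thesis by (simp add: diff)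
    qed
    then have "dual_apply h (z - x) \<le> 0" by (rule recession[OF z(1)])
    with z(2) show False by (simp add: diff)
  qed
qed

theorem theoremA1:
  fixes F :: "('a::locally_convex_space continuous_dual \<times> real) set"
    and K :: "'a set"
    and Fhat :: "('a continuous_dual \<times> real) set"
    and h :: "'a continuous_dual"
    and m :: ereal
    and Fhat_h :: "real set"
  assumes "K = {x. \<forall>(f, \<alpha>)\<in>F. dual_apply f x \<le> \<alpha>}"
    and "K \<noteq> {}"
    and "Fhat = closed_convex_cone_hull F"
    and "m = (SUP x\<in>K. ereal (dual_apply h x))"
    and "Fhat_h = {\<alpha>. (h, \<alpha>) \<in> Fhat}"
  shows "(Fhat_h \<noteq> {} \<longrightarrow> (\<exists>\<alpha>\<in>Fhat_h. (\<forall>\<beta>\<in>Fhat_h. \<alpha> \<le> \<beta>) \<and> m = ereal \<alpha>))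
       \<and> (Fhat_h = {} \<longrightarrow> m = \<infinity>)"
proof -
  have upper: "m \<le> ereal \<beta>" if "\<beta> \<in> Fhat_h" for \<beta>
    unfolding assms(4) using that assms(1,3,5)
    by (intro SUP_least) (auto intro: hull_imp_valid[where F = F and K = K])
  have finite_case: "\<exists>\<alpha>\<in>Fhat_h. m = ereal \<alpha>" if "m \<noteq> \<infinity>"
  proof -
    obtain z where "z \<in> K" using assms(2) by blast
    then have "ereal (dual_apply h z) \<le> m" unfolding assms(4) by (rule SUP_upper)
    with that obtain \<alpha> where \<alpha>: "m = ereal \<alpha>" by (cases m) auto
    have "(h, \<alpha>) \<in> closed_convex_cone_hull F"
    proof (rule sharp_bound_mem_hull)
      fix x assume "x \<in> {x. \<forall>(f, \<alpha>)\<in>F. dual_apply f x \<le> \<alpha>}"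
      then have "ereal (dual_apply h x) \<le> m"
        unfolding assms(4) using assms(1) by (intro SUP_upper) simp
      then show "dual_apply h x \<le> \<alpha>" by (simp add: \<alpha>)
    next
      fix b assume "b < \<alpha>"
      then have "ereal b < (SUP x\<in>K. ereal (dual_apply h x))" by (simp add: \<alpha> flip: assms(4))
      then show "\<exists>x\<in>{x. \<forall>(f, \<alpha>)\<in>F. dual_apply f x \<le> \<alpha>}. b < dual_apply h x"
        using assms(1) by (auto simp: less_SUP_iff)
    qed
    then show ?thesis using \<alpha> assms(3,5) by blast
  qed
  show ?thesis
  proof (intro conjI impI)
    assume "Fhat_h \<noteq> {}"
    then have "m \<noteq> \<infinity>" using upper by fastforce
    then show "\<exists>\<alpha>\<in>Fhat_h. (\<forall>\<beta>\<in>Fhat_h. \<alpha> \<le> \<beta>) \<and> m = ereal \<alpha>"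
      using finite_case upper by fastforce
  next
    assume "Fhat_h = {}"
    then show "m = \<infinity>" using finite_case by blast
  qed
qed

end
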